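(* For every set $P\subset\mathbb{R}^2$ consisting of $10$ points there exists a packing of unit disks in the plane such that every point of $P$ lies in at least one disk of the packing.
   Context: A unit disk is a closed disk of radius $1$ in the Euclidean plane $\mathbb{R}^2$. A packing of unit disks is a (finite or infinite) collection of unit disks that do not overlap, i.e. have pairwise disjoint interiors (equivalently, distinct disks have centers at distance at least $2$); tangent disks are allowed. A set of points is covered by a packing if each point of the set belongs to some disk of the packing. *)

theory Defs
  imports "HOL-Analysis.Analysis"
begin

definition unit_disk :: "(real ^ 2) set \<Rightarrow> bool" where
  "unit_disk D \<longleftrightarrow> (\<exists>c. D = cball c 1)"

text \<open>A packing is a set of disks, finite or infinite, so no disk is repeated. Only the interiors
  of distinct disks are required to be disjoint: tangent disks are allowed.\<close>

definition unit_disk_packing :: "(real ^ 2) set set \<Rightarrow> bool" where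
  "unit_disk_packing \<D> \<longleftrightarrow>
     (\<forall>D\<in>\<D>. unit_disk D) \<and>
     pairwise (\<lambda>D E. disjnt (interior D) (interior E)) \<D>"

definition covered_by :: "(real ^ 2) set \<Rightarrow> (real ^ 2) set set \<Rightarrow> bool" where
  "covered_by P \<D> \<longleftrightarrow> (\<forall>p\<in>P. \<exists>D\<in>\<D>. p \<in> D)"

end

theory Submission
  imports Defs
begin

text \<open>
  The densest lattice packing of unit disks, the hexagonal one, has density
  \<open>\<pi> / \<surd>12 \<approx> 0.9069\<close>, which exceeds \<open>9/10\<close>. Shift this packing by a uniformly random
  vector of a fundamental cell of its lattice. Each of the ten points is then left uncovered with
  probability \<open>1 - \<pi> / \<surd>12 < 1/10\<close>, so with positive probability all ten are covered by the same
  shifted packing.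

  In terms of areas: let \<open>G p\<close> be the set of shifts in the cell that put \<open>p\<close> in the interior of a
  disk. It is the open unit disk around \<open>p\<close> folded into the cell by lattice translations. Since lattice points
  have mutual distance at least \<open>2\<close> (\<open>dist_hex_point\<close>), the pieces of this disk do not overlap
  after folding, and since the cell tiles the plane, no area is lost (\<open>emeasure_le_folded\<close>). Hence
  \<open>G p\<close> has area at least \<open>\<pi>\<close>, and ten complements within a cell of area \<open>2\<surd>3\<close> are too
  small to cover it (\<open>hex_density_gt_nine_tenths\<close>).
\<close>

definition hex_point :: "int \<times> int \<Rightarrow> real ^ 2" where
  "hex_point l = vector [2 * of_int (fst l) + of_int (snd l), sqrt 3 * of_int (snd l)]"

text \<open>
  The lattice is generated by \<open>(2, 0)\<close> and \<open>(1, \<surd>3)\<close>. The half-open rectangle below is a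
  sheared copy of the parallelogram that these vectors span, and it also tiles the plane under the
  lattice: the row of translates at height \<open>\<surd>3 b\<close> is merely shifted by \<open>b\<close>. Membership in it decouples the coordinates, and its area is that of a box.
\<close>

definition hex_cell :: "(real ^ 2) set" where
  "hex_cell = {x. 0 \<le> x $ 1 \<and> x $ 1 < 2 \<and> 0 \<le> x $ 2 \<and> x $ 2 < sqrt 3}"

lemma hex_point_nth [simp]:
  "hex_point l $ 1 = 2 * of_int (fst l) + of_int (snd l)"
  "hex_point l $ 2 = sqrt 3 * of_int (snd l)"
  by (simp_all add: hex_point_def)

text \<open>
  The squared length of a lattice vector is \<open>4 (a\<^sup>2 + a b + b\<^sup>2)\<close>, where the quadratic form is
  positive definite and takes integer values.
\<close>

lemma dist_hex_point:
  assumes "l \<noteq> m"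
  shows "dist (hex_point l) (hex_point m) \<ge> 2"
proof -
  define a b where "a = fst l - fst m" and "b = snd l - snd m"
  have ab: "a \<noteq> 0 \<or> b \<noteq> 0"
    using assms by (auto simp: a_def b_def prod_eq_iff)
  have "a\<^sup>2 + a * b + b\<^sup>2 > 0"
  proof -
    have "2 * (a\<^sup>2 + a * b + b\<^sup>2) = a\<^sup>2 + b\<^sup>2 + (a + b)\<^sup>2"
      by (simp add: power2_eq_square algebra_simps)
    moreover have "a\<^sup>2 + b\<^sup>2 > 0"
      using ab by (simp add: sum_power2_gt_zero_iff)
    ultimately have "0 < 2 * (a\<^sup>2 + a * b + b\<^sup>2)"
      by (metis add_pos_nonneg zero_le_power2)
    thus ?thesis
      by (simp only: zero_less_mult_iff) simp
  qed
  hence "real_of_int (a\<^sup>2 + a * b + b\<^sup>2) \<ge> 1"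
    by (simp only: of_int_1_le_iff int_one_le_iff_zero_less)
  moreover have "(dist (hex_point l) (hex_point m))\<^sup>2 = 4 * real_of_int (a\<^sup>2 + a * b + b\<^sup>2)"
  proof -
    have "(dist (hex_point l) (hex_point m))\<^sup>2
        = (2 * of_int a + of_int b)\<^sup>2 + (sqrt 3 * of_int b)\<^sup>2"
      by (simp add: dist_norm power2_norm_eq_inner inner_vec_def sum_2 a_def b_def
          flip: power2_eq_square) (simp add: algebra_simps)
    also have "\<dots> = 4 * real_of_int (a\<^sup>2 + a * b + b\<^sup>2)"
      by (simp add: power2_eq_square algebra_simps)
    finally show ?thesis .
  qed
  ultimately have "2\<^sup>2 \<le> (dist (hex_point l) (hex_point m))\<^sup>2"
    by simp
  thus ?thesis
    by (rule power2_le_imp_le) simp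
qed

lemma disjnt_unit_balls:
  fixes c d :: "'a::metric_space"
  assumes "dist c d \<ge> 2"
  shows "disjnt (ball c 1) (ball d 1)"
proof -
  have False if "dist c x < 1" "dist d x < 1" for x
    using assms that dist_triangle2[of c d x] by linarith
  thus ?thesis
    by (auto simp: disjnt_iff)
qed

lemma unit_disk_packing_hex:
  "unit_disk_packing (range (\<lambda>l. cball (x + hex_point l) 1))"
proof -
  have "disjnt (ball (x + hex_point l) 1) (ball (x + hex_point m) 1)" if "l \<noteq> m" for l m
    using dist_hex_point[OF that] by (intro disjnt_unit_balls) simp
  thus ?thesis
    unfolding unit_disk_packing_def
    by (intro conjI pairwise_imageI) (auto simp: unit_disk_def interior_cball)
qed

text \<open>
  Choosing the row first leaves a one-dimensional rounding problem with step \<open>2\<close> in that row.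
\<close>

lemma hex_cell_covers: "\<exists>l. x - hex_point l \<in> hex_cell"
proof -
  define b where "b = \<lfloor>x $ 2 / sqrt 3\<rfloor>"
  define a where "a = \<lfloor>(x $ 1 - of_int b) / 2\<rfloor>"
  have "of_int b \<le> x $ 2 / sqrt 3" "x $ 2 / sqrt 3 < of_int b + 1"
    "of_int a \<le> (x $ 1 - of_int b) / 2" "(x $ 1 - of_int b) / 2 < of_int a + 1"
    unfolding a_def b_def by linarith+
  hence "x - hex_point (a, b) \<in> hex_cell"
    by (auto simp: hex_cell_def field_simps)
  thus ?thesis ..
qed

lemma hex_cell_translates_unique:
  assumes "x - hex_point l \<in> hex_cell" "x - hex_point m \<in> hex_cell"
  shows "l = m"
proof -
  have "sqrt 3 * of_int (snd l) < sqrt 3 * (of_int (snd m) + 1)"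
    "sqrt 3 * of_int (snd m) < sqrt 3 * (of_int (snd l) + 1)"
    using assms unfolding hex_cell_def by (simp_all add: distrib_left)
  hence "of_int (snd l) < (of_int (snd m) + 1 :: real)" "of_int (snd m) < (of_int (snd l) + 1 :: real)"
    by (simp_all only: mult_less_cancel_left_pos real_sqrt_gt_0_iff zero_less_numeral)
  hence snd: "snd l = snd m"
    by linarith
  have "fst l = fst m"
    using assms unfolding hex_cell_def by (simp add: snd)
  with snd show ?thesis
    by (simp add: prod_eq_iff)
qed

lemma sets_hex_cell [measurable]: "hex_cell \<in> sets borel"
  unfolding hex_cell_def by measurable

lemma emeasure_hex_cell_le: "emeasure lborel hex_cell \<le> ennreal (2 * sqrt 3)"
proof -
  have "hex_cell \<subseteq> cbox 0 (vector [2, sqrt 3])"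
    by (auto simp: hex_cell_def mem_box_cart forall_2)
  hence "emeasure lborel hex_cell \<le> emeasure lborel (cbox 0 (vector [2, sqrt 3] :: real ^ 2))"
    by (intro emeasure_mono) auto
  also have "\<dots> = ennreal (measure lborel (cbox 0 (vector [2, sqrt 3] :: real ^ 2)))"
    by (rule emeasure_eq_ennreal_measure) (simp add: emeasure_lborel_cbox_eq)
  also have "measure lborel (cbox 0 (vector [2, sqrt 3] :: real ^ 2)) = 2 * sqrt 3"
    by (subst content_cbox_cart) (auto simp: interval_ne_empty_cart forall_2 UNIV_2)
  finally show ?thesis .
qed

lemma emeasure_lborel_translate:
  fixes a :: "'a::euclidean_space"
  assumes "A \<in> sets borel"
  shows "emeasure lborel {x. x + a \<in> A} = emeasure lborel A"
proof -
  have "emeasure lborel A = emeasure (distr lborel borel ((+) a)) A"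
    by (simp add: lborel_distr_plus)
  also have "\<dots> = emeasure lborel {x. x + a \<in> A}"
    using assms by (subst emeasure_distr) (auto simp: vimage_def add.commute)
  finally show ?thesis ..
qed

text \<open>
  Folding a set into the cell: cut \<open>S\<close> along the tiling and translate every piece back to the cell
  at the origin. If \<open>S\<close> contains no two distinct points that differ by a lattice vector, the
  translated pieces stay disjoint, so countable additivity preserves the area.
\<close>

lemma emeasure_le_folded:
  assumes S [measurable]: "S \<in> sets borel"
    and inj: "\<And>x l m. x + hex_point l \<in> S \<Longrightarrow> x + hex_point m \<in> S \<Longrightarrow> l = m"
  shows "emeasure lborel S \<le> emeasure lborel {x \<in> hex_cell. \<exists>l. x + hex_point l \<in> S}"
proof -
  define A where "A l = {y \<in> S. y - hex_point l \<in> hex_cell}" for l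
  define B where "B l = {x \<in> hex_cell. x + hex_point l \<in> S}" for l
  have [measurable]: "A l \<in> sets borel" "B l \<in> sets borel" for l
    unfolding A_def B_def by measurable
  have "S = (\<Union>l. A l)"
    using hex_cell_covers by (auto simp: A_def)
  also have "emeasure lborel \<dots> = (\<integral>\<^sup>+ l. emeasure lborel (A l) \<partial>count_space UNIV)"
    using hex_cell_translates_unique
    by (intro emeasure_UN_countable) (auto simp: A_def disjoint_family_on_def)
  also have "\<dots> = (\<integral>\<^sup>+ l. emeasure lborel (B l) \<partial>count_space UNIV)"
  proof (intro nn_integral_cong)
    fix l
    have "B l = {x. x + hex_point l \<in> A l}"
      by (auto simp: A_def B_def)
    thus "emeasure lborel (A l) = emeasure lborel (B l)"
      by (simp add: emeasure_lborel_translate)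
  qed
  also have "\<dots> = emeasure lborel (\<Union>l. B l)"
    using inj by (intro emeasure_UN_countable [symmetric]) (auto simp: B_def disjoint_family_on_def)
  also have "(\<Union>l. B l) = {x \<in> hex_cell. \<exists>l. x + hex_point l \<in> S}"
    by (auto simp: B_def)
  finally show ?thesis by simp
qed

text \<open>
  A lower bound for \<open>\<pi>\<close> beyond \<open>9\<surd>3 / 5 \<approx> 3.118\<close> comes from Machin's formula
  \<open>\<pi>/4 = 4 arctan (1/5) - arctan (1/239)\<close>; for the first term, two terms of the arctangent
  series suffice, which gives \<open>\<pi> > 3.14\<close>.
\<close>

lemma arctan_ge_cubic:
  assumes "0 \<le> (x::real)"
  shows "x - x ^ 3 / 3 \<le> arctan x"
proof -
  have "arctan 0 - (0 - 0 ^ 3 / 3) \<le> arctan x - (x - x ^ 3 / 3)"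
  proof (rule DERIV_nonneg_imp_nondecreasing[OF assms])
    fix t :: real
    have "((\<lambda>x. arctan x - (x - x ^ 3 / 3)) has_real_derivative
        inverse (1 + t\<^sup>2) - (1 - t\<^sup>2)) (at t)"
      by (auto intro!: derivative_eq_intros)
    moreover have "0 \<le> inverse (1 + t\<^sup>2) - (1 - t\<^sup>2)"
    proof -
      have "(1 - t\<^sup>2) * (1 + t\<^sup>2) \<le> 1"
        by (simp add: algebra_simps)
      moreover have "0 < 1 + t\<^sup>2"
        by (simp add: add_pos_nonneg)
      ultimately show ?thesis
        by (simp add: pos_le_divide_eq inverse_eq_divide)
    qed
    ultimately show "\<exists>y. ((\<lambda>x. arctan x - (x - x ^ 3 / 3)) has_real_derivative y) (at t) \<and> 0 \<le> y"
      by blast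
  qed
  thus ?thesis by simp
qed

lemma hex_density_gt_nine_tenths: "9 / 10 < pi / (2 * sqrt 3)"
proof -
  have "(1/5 :: real) - (1/5) ^ 3 / 3 \<le> arctan (1/5)"
    by (rule arctan_ge_cubic) simp
  moreover have "arctan (1/239) \<le> 1/239"
    by (rule arctan_le_self) simp
  ultimately have "pi > 314 / 100"
    using machin by (simp add: power3_eq_cube)
  moreover have "sqrt 3 < 174 / 100"
    by (rule real_less_lsqrt) (simp_all add: power2_eq_square)
  ultimately show ?thesis
    by (simp add: field_simps)
qed

theorem theorem2p1:
  fixes P :: "(real ^ 2) set"
  assumes "card P = 10"
  shows "\<exists>\<D>. unit_disk_packing \<D> \<and> covered_by P \<D>"
proof -
  have fin: "finite P"
    using assms by (metis card.infinite zero_neq_numeral)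
  define G where "G p = {x \<in> hex_cell. \<exists>l. x + hex_point l \<in> ball p 1}" for p
  have [measurable]: "G p \<in> sets borel" for p
    unfolding G_def mem_ball by measurable
  have cell_finite: "emeasure lborel hex_cell < \<infinity>"
    using emeasure_hex_cell_le by (rule order.strict_trans1) simp
  hence cell: "hex_cell \<in> fmeasurable lborel"
    by (intro fmeasurableI) auto
  have G_fm: "G p \<in> fmeasurable lborel" for p
    by (rule fmeasurableI2[OF cell]) (auto simp: G_def)
  have G_area: "pi \<le> measure lborel (G p)" for p
  proof -
    \<comment> \<open>The open ball is needed here: closed unit disks around tangent centres share a point,
      so folding would not be injective.\<close>
    have "ennreal pi = emeasure lborel (ball p 1)"
      by (simp add: emeasure_ball unit_ball_vol_2)
    also have "\<dots> \<le> emeasure lborel (G p)"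
      unfolding G_def
    proof (rule emeasure_le_folded)
      fix x l m
      assume "x + hex_point l \<in> ball p 1" "x + hex_point m \<in> ball p 1"
      hence "dist (x + hex_point l) (x + hex_point m) < 2"
        using dist_triangle3[of "x + hex_point l" "x + hex_point m" p] by simp
      thus "l = m"
        using dist_hex_point[of l m] by (cases "l = m") auto
    qed simp
    finally show ?thesis
      using G_fm[of p] by (simp add: emeasure_eq_measure2)
  qed
  \<comment> \<open>Union bound: otherwise the ten sets of bad shifts, each of area at most that of the cell minus
    \<open>\<pi>\<close>, would cover the cell.\<close>
  have "\<exists>x \<in> hex_cell. \<forall>p\<in>P. x \<in> G p"
  proof (rule ccontr)
    assume "\<not> ?thesis"
    hence sub: "hex_cell \<subseteq> (\<Union>p\<in>P. hex_cell - G p)"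
      by blast
    have "measure lborel hex_cell \<le> measure lborel (\<Union>p\<in>P. hex_cell - G p)"
      using cell fin G_fm
      by (intro measure_mono_fmeasurable[OF sub] fmeasurable.finite_UN fmeasurable.Diff) auto
    also have "\<dots> \<le> (\<Sum>p\<in>P. measure lborel (hex_cell - G p))"
      using cell fin by (intro measure_UNION_le) auto
    also have "\<dots> \<le> (\<Sum>p\<in>P. measure lborel hex_cell - pi)"
    proof (rule sum_mono)
      fix p
      have "measure lborel (hex_cell - G p) = measure lborel hex_cell - measure lborel (G p)"
        using cell G_fm cell_finite by (intro measure_Diff) (auto simp: G_def)
      thus "measure lborel (hex_cell - G p) \<le> measure lborel hex_cell - pi"
        using G_area[of p] by simp
    qed
    also have "\<dots> = 10 * (measure lborel hex_cell - pi)"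
      using assms by simp
    finally have "10 * pi \<le> 9 * measure lborel hex_cell"
      by simp
    moreover have "measure lborel hex_cell \<le> 2 * sqrt 3"
      unfolding measure_def using emeasure_hex_cell_le by (rule enn2real_leI[rotated]) simp
    ultimately show False
      using hex_density_gt_nine_tenths by (simp add: field_simps)
  qed
  then obtain x where x: "x \<in> G p" if "p \<in> P" for p
    by blast
  have "covered_by P (range (\<lambda>l. cball (x + hex_point l) 1))"
    unfolding covered_by_def
  proof
    fix p
    assume "p \<in> P"
    then obtain l where "x + hex_point l \<in> ball p 1"
      using x unfolding G_def by blast
    hence "p \<in> cball (x + hex_point l) 1"
      by (simp add: dist_commute)
    thus "\<exists>D\<in>range (\<lambda>l. cball (x + hex_point l) 1). p \<in> D"
      by blast
  qed
  with unit_disk_packing_hex show ?thesis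
    by blast
qed

end
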